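(* Let $p\in\mathbb{N}$. For any complex numbers $a_1,\dots,a_p$, $b_1,\dots,b_p$ the identity $$\sum_{k=1}^{p}\frac{\prod_{i=1}^{p}\sin(\pi(b_i-a_k))}{\prod_{1\le i\le p,\ i\ne k}\sin(\pi(a_i-a_k))}=\sin\left(\pi\sum_{k=1}^p(b_k-a_k)\right)$$ holds whenever $a_i-a_k\notin\mathbb{Z}$ for all $i\ne k$; if some of the differences $a_i-a_k$ ($i\neq k$) are integers, the right-hand side gives a continuous extension of the left-hand side. *)

theory Defs
  imports "HOL-Analysis.Analysis"
begin

text \<open>
  The number \<open>p\<close> of parameters is the cardinality of the finite index type \<open>'p\<close>, so the
  parameter tuples \<open>a\<close> and \<open>b\<close> are points of \<open>complex ^ 'p\<close>.
\<close>

definition lhs_sum :: "complex ^ 'p \<Rightarrow> complex ^ 'p \<Rightarrow> complex" where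
  "lhs_sum a b =
     (\<Sum>k\<in>UNIV. (\<Prod>i\<in>UNIV. sin (of_real pi * (b $ i - a $ k))) /
                (\<Prod>i\<in>UNIV - {k}. sin (of_real pi * (a $ i - a $ k))))"

definition rhs_sine :: "complex ^ 'p \<Rightarrow> complex ^ 'p \<Rightarrow> complex" where
  "rhs_sine a b = sin (of_real pi * (\<Sum>k\<in>UNIV. b $ k - a $ k))"

text \<open>
  The set on which no denominator of \<^const>\<open>lhs_sum\<close> vanishes.  Elsewhere \<^const>\<open>lhs_sum\<close>
  has junk values (division by zero), so it is only to be considered on this set.
\<close>

definition nonresonant :: "((complex ^ 'p) \<times> (complex ^ 'p)) set" where
  "nonresonant = {(a, b). \<forall>i k. i \<noteq> k \<longrightarrow> a $ i - a $ k \<notin> \<int>}"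

end

theory Submission
  imports Defs "HOL-Computational_Algebra.Polynomial"
begin

text \<open>
  In the variables \<open>x\<^sub>k = exp (2 \<pi> \<i> a\<^sub>k)\<close>, \<open>y\<^sub>k = exp (2 \<pi> \<i> b\<^sub>k)\<close> the identity becomes
  \<open>(\<Sum>k. (\<Prod>i. y\<^sub>i - x\<^sub>k) / (x\<^sub>k * (\<Prod>i\<noteq>k. x\<^sub>i - x\<^sub>k))) = \<Prod>y / \<Prod>x - 1\<close>. Up to the factor
  \<open>(-1)\<^sup>p * \<Prod>x\<close> this is the value at \<open>z = 0\<close> of the Lagrange interpolation formula, with nodes
  \<open>x\<^sub>k\<close>, for \<open>(\<Prod>i. z - y\<^sub>i) - (\<Prod>i. z - x\<^sub>i)\<close>, whose degree is less than \<open>p\<close> because the leading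
  terms cancel. The nonresonant points are dense because moving \<open>a\<close> in an imaginary direction with
  distinct entries meets the resonances only finitely often.
\<close>

text \<open>Subtracting \<open>\<Prod>i\<in>A. z - x i\<close> changes no value at the nodes and
  cancels the leading term, so plain Lagrange interpolation on \<open>card A\<close> nodes
  reproduces the difference.\<close>

lemma lagrange_monic_prod:
  fixes x y :: "'a \<Rightarrow> 'b :: field"
  assumes "finite A" and inj: "inj_on x A"
  shows "(\<Prod>i\<in>A. z - y i) = (\<Prod>i\<in>A. z - x i) +
    (\<Sum>k\<in>A. (\<Prod>i\<in>A. x k - y i) / (\<Prod>i\<in>A - {k}. x k - x i) * (\<Prod>i\<in>A - {k}. z - x i))"
proof -
  define c where "c k = (\<Prod>i\<in>A. x k - y i) / (\<Prod>i\<in>A - {k}. x k - x i)" for k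
  define P where "P = (\<Prod>i\<in>A. [:- y i, 1:])"
  define Q where "Q = (\<Prod>i\<in>A. [:- x i, 1:])"
  define S where "S = (\<Sum>k\<in>A. smult (c k) (\<Prod>i\<in>A - {k}. [:- x i, 1:]))"
  have monic: "degree (\<Prod>i\<in>B. [:- w i, 1:]) = card B" "lead_coeff (\<Prod>i\<in>B. [:- w i, 1:]) = 1"
    for B and w :: "'a \<Rightarrow> 'b"
    by (simp add: degree_prod_sum_eq, simp only: lead_coeff_prod) simp
  have S: "coeff S n = 0" if "card A \<le> n" for n
  proof -
    have "coeff (\<Prod>i\<in>A - {k}. [:- x i, 1:]) n = 0" if "k \<in> A" for k
      using that \<open>card A \<le> n\<close> \<open>finite A\<close> monic(1)[of x "A - {k}"] card_Diff1_less[of A k]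
      by (intro coeff_eq_0) linarith
    then show ?thesis
      by (simp add: S_def coeff_sum)
  qed
  \<comment> \<open>Both sides have degree at most \<open>card A\<close>. Equal coefficients in that
    degree leave a difference of smaller degree, which the \<open>card A\<close> nodes force to be
    zero.\<close>
  have "P = Q + S"
  proof (rule poly_eqI_degree_lead_coeff[where A = "x ` A" and n = "card A"])
    show "card A \<le> card (x ` A)"
      by (simp add: card_image inj)
    show "degree P \<le> card A"
      by (simp add: P_def monic)
    show "degree (Q + S) \<le> card A"
      using S by (intro degree_add_le) (auto simp: Q_def monic intro!: degree_le)
    show "coeff P (card A) = coeff (Q + S) (card A)"
      using S[of "card A"] monic(2)[of y A] monic(2)[of x A]
      by (simp add: P_def Q_def monic(1))
  next
    fix t assume "t \<in> x ` A"
    then obtain k where k: "k \<in> A" and t: "t = x k" by blast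
    \<comment> \<open>For \<open>j \<noteq> k\<close> the product contains the factor
      \<open>x k - x k\<close>.\<close>
    have "(\<Sum>j\<in>A. c j * (\<Prod>i\<in>A - {j}. t - x i)) = (\<Sum>j\<in>{k}. c j * (\<Prod>i\<in>A - {j}. t - x i))"
      using \<open>finite A\<close> k t by (intro sum.mono_neutral_right) auto
    also have "\<dots> = (\<Prod>i\<in>A. t - y i)"
      using \<open>finite A\<close> k inj by (auto simp: c_def t inj_on_def)
    finally show "poly P t = poly (Q + S) t"
      using \<open>finite A\<close> k by (auto simp: P_def Q_def S_def poly_prod poly_sum t)
  qed
  then have "poly P z = poly (Q + S) z" by simp
  then show ?thesis
    by (simp add: P_def Q_def S_def c_def poly_prod poly_sum)
qed

lemma sum_prod_diff_div:
  fixes x y :: "'a \<Rightarrow> 'b :: field"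
  assumes "finite A" and inj: "inj_on x A" and nz: "\<And>i. i \<in> A \<Longrightarrow> x i \<noteq> 0"
  shows "(\<Sum>k\<in>A. (\<Prod>i\<in>A. y i - x k) / (x k * (\<Prod>i\<in>A - {k}. x i - x k))) =
    (\<Prod>i\<in>A. y i) / (\<Prod>i\<in>A. x i) - 1"
proof -
  define X where "X = (\<Prod>i\<in>A. x i)"
  have X: "X \<noteq> 0" using assms by (simp add: X_def)
  have swap: "(\<Prod>i\<in>B. u i - w i) = (-1) ^ card B * (\<Prod>i\<in>B. w i - u i)" for B and u w :: "'a \<Rightarrow> 'b"
  proof -
    have "(\<Prod>i\<in>B. u i - w i) = (\<Prod>i\<in>B. (-1) * (w i - u i))" by simp
    then show ?thesis by (simp only: prod.distrib prod_constant)
  qed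
  \<comment> \<open>The two products over \<open>A - {k}\<close> contribute the same sign, which
    cancels; the sign of the numerator remains. The factor \<open>1 / x k\<close> comes from writing
    the product of the other nodes as \<open>X / x k\<close>.\<close>
  have summand: "(\<Prod>i\<in>A. x k - y i) / (\<Prod>i\<in>A - {k}. x k - x i) * (\<Prod>i\<in>A - {k}. 0 - x i) =
      (-1) ^ card A * X * ((\<Prod>i\<in>A. y i - x k) / (x k * (\<Prod>i\<in>A - {k}. x i - x k)))" if "k \<in> A" for k
  proof -
    have "X = x k * (\<Prod>i\<in>A - {k}. x i)"
      using that \<open>finite A\<close> by (simp add: X_def prod.remove)
    then show ?thesis
      using nz[OF that]
      by (simp only: swap[of "\<lambda>_. x k"] swap[of "\<lambda>_. 0"]) (simp add: mult_ac)
  qed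
  have "(-1) ^ card A * (\<Prod>i\<in>A. y i) = (-1) ^ card A * X + (-1) ^ card A * X *
      (\<Sum>k\<in>A. (\<Prod>i\<in>A. y i - x k) / (x k * (\<Prod>i\<in>A - {k}. x i - x k)))"
  proof -
    have "(-1) ^ card A * (\<Prod>i\<in>A. y i) = (-1) ^ card A * X + (\<Sum>k\<in>A.
        (\<Prod>i\<in>A. x k - y i) / (\<Prod>i\<in>A - {k}. x k - x i) * (\<Prod>i\<in>A - {k}. 0 - x i))"
      using lagrange_monic_prod[OF \<open>finite A\<close> inj, of 0 y] by (simp add: prod_uminus X_def)
    then show ?thesis
      by (simp only: summand sum_distrib_left cong: sum.cong)
  qed
  then have "(\<Prod>i\<in>A. y i) = X + X *
      (\<Sum>k\<in>A. (\<Prod>i\<in>A. y i - x k) / (x k * (\<Prod>i\<in>A - {k}. x i - x k)))"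
    by (simp add: mult.assoc flip: distrib_left)
  then show ?thesis
    using X by (simp add: field_simps flip: X_def)
qed

text \<open>The half exponentials put the polynomial variables into the numerator as squares, and
  the denominator splits into factors in \<open>a\<close> and \<open>b\<close> alone, so products
  over an index can be taken factor by factor.\<close>

lemma sin_diff_exp:
  fixes a b :: complex
  shows "sin (of_real pi * (b - a)) =
    (exp (\<i> * pi * b) ^ 2 - exp (\<i> * pi * a) ^ 2) / (2 * \<i> * exp (\<i> * pi * b) * exp (\<i> * pi * a))"
proof -
  have "exp (\<i> * (pi * (b - a))) = exp (\<i> * pi * b) / exp (\<i> * pi * a)"
    and "exp (- (\<i> * (pi * (b - a)))) = exp (\<i> * pi * a) / exp (\<i> * pi * b)"
    by (simp_all add: algebra_simps flip: exp_diff)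
  then show ?thesis
    by (simp add: sin_exp_eq field_simps power2_eq_square)
qed

text \<open>This turns nonresonance into distinctness of the interpolation nodes. The denominator in
  \<open>sin_diff_exp\<close> never vanishes, so the squares agree exactly at the zeros of the
  sine.\<close>

lemma exp_2pi_eq_iff:
  fixes a b :: complex
  shows "exp (\<i> * pi * a) ^ 2 = exp (\<i> * pi * b) ^ 2 \<longleftrightarrow> a - b \<in> \<int>"
proof -
  have "exp (\<i> * pi * a) ^ 2 = exp (\<i> * pi * b) ^ 2 \<longleftrightarrow> sin (of_real pi * (a - b)) = 0"
    unfolding sin_diff_exp by simp
  also have "\<dots> \<longleftrightarrow> a - b \<in> \<int>"
  proof -
    have "of_real pi * (a - b) = of_real (of_int n * pi) \<longleftrightarrow> a - b = of_int n" for n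
      by (simp add: mult.commute)
    then show ?thesis
      by (auto simp: Complex_Transcendental.sin_eq_0 Ints_def)
  qed
  finally show ?thesis .
qed

lemma lhs_sum_eq_rhs_sine:
  fixes a b :: "complex ^ 'p"
  assumes nonres: "\<And>i k. i \<noteq> k \<Longrightarrow> a $ i - a $ k \<notin> \<int>"
  shows "lhs_sum a b = rhs_sine a b"
proof -
  define u where "u i = exp (\<i> * pi * a $ i)" for i
  define v where "v i = exp (\<i> * pi * b $ i)" for i
  define U where "U = (\<Prod>i\<in>UNIV. u i)"
  define V where "V = (\<Prod>i\<in>UNIV. v i)"
  have nz [simp]: "u i \<noteq> 0" "v i \<noteq> 0" "U \<noteq> 0" "V \<noteq> 0" for i
    by (simp_all add: u_def v_def U_def V_def)
  have inj: "inj (\<lambda>i. u i ^ 2)"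
    using nonres by (auto simp: inj_def u_def exp_2pi_eq_iff)
  have summand: "(\<Prod>i\<in>UNIV. sin (of_real pi * (b $ i - a $ k))) /
      (\<Prod>i\<in>UNIV - {k}. sin (of_real pi * (a $ i - a $ k))) =
      U / (2 * \<i> * V) *
      ((\<Prod>i\<in>UNIV. v i ^ 2 - u k ^ 2) / (u k ^ 2 * (\<Prod>i\<in>UNIV - {k}. u i ^ 2 - u k ^ 2)))" for k
  proof -
    \<comment> \<open>One factor \<open>2 * \<i> * u k\<close> is split off because the denominator
      has one sine fewer; the remaining power cancels against the one in \<open>den\<close>.\<close>
    have num: "(\<Prod>i\<in>UNIV. sin (of_real pi * (b $ i - a $ k))) =
        (\<Prod>i\<in>UNIV. v i ^ 2 - u k ^ 2) / ((2 * \<i> * u k) * (2 * \<i> * u k) ^ (CARD('p) - 1) * V)"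
    proof -
      have "(2 * \<i> * u k) * (2 * \<i> * u k) ^ (CARD('p) - 1) = (2 * \<i> * u k) ^ CARD('p)"
        by (simp flip: power_Suc)
      moreover have "(\<Prod>i\<in>UNIV. sin (of_real pi * (b $ i - a $ k))) =
        (\<Prod>i\<in>UNIV. (v i ^ 2 - u k ^ 2) / ((2 * \<i> * u k) * v i))"
        by (simp only: sin_diff_exp u_def v_def mult_ac)
      ultimately show ?thesis
        by (simp only: prod_dividef prod.distrib prod_constant power_mult_distrib V_def)
    qed
    have den: "(\<Prod>i\<in>UNIV - {k}. sin (of_real pi * (a $ i - a $ k))) =
        (\<Prod>i\<in>UNIV - {k}. u i ^ 2 - u k ^ 2) / ((2 * \<i> * u k) ^ (CARD('p) - 1) * (U / u k))"
    proof -
      have "U = u k * (\<Prod>i\<in>UNIV - {k}. u i)"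
        by (simp add: U_def prod.remove)
      then have "U / u k = (\<Prod>i\<in>UNIV - {k}. u i)" by simp
      moreover have "(\<Prod>i\<in>UNIV - {k}. sin (of_real pi * (a $ i - a $ k))) =
        (\<Prod>i\<in>UNIV - {k}. (u i ^ 2 - u k ^ 2) / ((2 * \<i> * u k) * u i))"
        by (simp only: sin_diff_exp u_def mult_ac)
      moreover have "card (UNIV - {k}) = CARD('p) - 1" by simp
      ultimately show ?thesis
        by (simp only: prod_dividef prod.distrib prod_constant power_mult_distrib)
    qed
    have nz': "(2 * \<i> * u k) ^ (CARD('p) - 1) \<noteq> 0" by simp
    \<comment> \<open>For \<open>D = 0\<close> both sides are 0, since division by zero gives
      0.\<close>
    have alg: "(N / (2 * \<i> * w * W * V)) / (D / (W * (U / w))) = U / (2 * \<i> * V) * (N / (w ^ 2 * D))"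
      if "W \<noteq> 0" "w \<noteq> 0" for N D w W :: complex
      using that by (cases "D = 0") (simp_all add: field_simps power2_eq_square)
    show ?thesis
      unfolding num den by (rule alg[OF nz' nz(1)])
  qed
  have "lhs_sum a b = U / (2 * \<i> * V) * ((\<Prod>i\<in>UNIV. v i ^ 2) / (\<Prod>i\<in>UNIV. u i ^ 2) - 1)"
    unfolding lhs_sum_def summand sum_distrib_left[symmetric]
    by (subst sum_prod_diff_div) (use inj in auto)
  also have "\<dots> = (V ^ 2 - U ^ 2) / (2 * \<i> * V * U)"
    by (simp add: prod.distrib field_simps power2_eq_square flip: U_def V_def)
  also have "\<dots> = rhs_sine a b"
  proof -
    \<comment> \<open>\<open>U\<close> and \<open>V\<close> are the half exponentials of the two
      sums, so \<open>sin_diff_exp\<close> read backwards yields a single sine.\<close>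
    have "U = exp (\<i> * pi * (\<Sum>k\<in>UNIV. a $ k))" "V = exp (\<i> * pi * (\<Sum>k\<in>UNIV. b $ k))"
      by (simp_all add: U_def V_def u_def v_def sum_distrib_left exp_sum)
    then show ?thesis
      by (simp only: rhs_sine_def sum_subtractf sin_diff_exp)
  qed
  finally show ?thesis .
qed

lemma closure_nonresonant:
  "closure (nonresonant :: ((complex ^ 'p) \<times> (complex ^ 'p)) set) = UNIV"
proof -
  have "(a, b) \<in> closure nonresonant" for a b :: "complex ^ 'p"
  proof -
    obtain c :: "'p \<Rightarrow> nat" where c: "inj c"
      using finite_imp_inj_to_nat_seg[of "UNIV :: 'p set"] by auto
    \<comment> \<open>Distinct speeds \<open>c i\<close> make the imaginary part of every difference
      of two coordinates a nonconstant affine function of \<open>t\<close>.\<close>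
    define f where "f t = (\<chi> i. a $ i + \<i> * of_real (t * real (c i)))" for t :: real
    have "\<forall>\<^sub>F t in at 0. i \<noteq> k \<longrightarrow> f t $ i - f t $ k \<notin> \<int>" for i k
    proof (cases "i = k")
      case False
      have ne: "real (c i) - real (c k) \<noteq> 0"
        using c False by (auto simp: inj_def)
      \<comment> \<open>The only \<open>t\<close> at which this imaginary part vanishes, hence the
        only possible resonance of the pair. Finitely many pairs exclude finitely many
        \<open>t\<close>.\<close>
      define t0 where "t0 = (Im (a $ k) - Im (a $ i)) / (real (c i) - real (c k))"
      have "t = t0" if "f t $ i - f t $ k \<in> \<int>" for t
      proof -
        from that have "Im (f t $ i - f t $ k) = 0" by (metis Ints_cases complex_Im_of_int)
        then show ?thesis
          using ne by (simp add: f_def t0_def field_simps)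
      qed
      moreover have "\<forall>\<^sub>F t in at 0. t \<noteq> t0"
        by (rule eventually_neq_at_within)
      ultimately show ?thesis
        by (auto elim: eventually_mono)
    qed simp
    then have "\<forall>\<^sub>F t in at 0. (f t, b) \<in> nonresonant"
      unfolding nonresonant_def by (simp add: eventually_all_finite)
    moreover have "((\<lambda>t. (f t, b)) \<longlongrightarrow> (a, b)) (at 0)"
    proof -
      have "((\<lambda>t. f t $ i) \<longlongrightarrow> a $ i) (at 0)" for i
        unfolding f_def by (auto intro!: tendsto_eq_intros)
      then show ?thesis
        by (intro tendsto_Pair vec_tendstoI tendsto_const)
    qed
    ultimately show ?thesis
      using closure_subset
      by (intro Lim_in_closed_set[OF closed_closure]) (auto elim!: eventually_mono)
  qed
  then show ?thesis by auto
qed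

lemma continuous_on_rhs_sine:
  "continuous_on A (\<lambda>(a :: complex ^ 'p, b). rhs_sine a b)"
  unfolding rhs_sine_def case_prod_unfold by (intro continuous_intros)

text \<open>Density of \<open>nonresonant\<close> keeps the limit from being vacuous at a resonant
  point, and restricting the limit to that set avoids the junk values of
  \<open>lhs_sum\<close>.\<close>

theorem corollary3p7:
  shows "(\<forall>a b :: complex ^ 'p. (\<forall>i k. i \<noteq> k \<longrightarrow> a $ i - a $ k \<notin> \<int>) \<longrightarrow> lhs_sum a b = rhs_sine a b) \<and>
    closure (nonresonant :: ((complex ^ 'p) \<times> (complex ^ 'p)) set) = UNIV \<and>
    continuous_on UNIV (\<lambda>(a :: complex ^ 'p, b). rhs_sine a b) \<and>
    (\<forall>a b :: complex ^ 'p. (\<exists>i k. i \<noteq> k \<and> a $ i - a $ k \<in> \<int>) \<longrightarrow>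
      ((\<lambda>(a', b'). lhs_sum a' b') \<longlongrightarrow> rhs_sine a b) (at (a, b) within nonresonant))"
proof (intro conjI allI impI)
  fix a b :: "complex ^ 'p"
  assume "\<forall>i k. i \<noteq> k \<longrightarrow> a $ i - a $ k \<notin> \<int>"
  then show "lhs_sum a b = rhs_sine a b" by (intro lhs_sum_eq_rhs_sine) blast
next
  fix a b :: "complex ^ 'p"
  have "((\<lambda>(a', b'). rhs_sine a' b') \<longlongrightarrow> rhs_sine a b) (at (a, b) within nonresonant)"
    using continuous_on_rhs_sine[of UNIV] by (auto simp: continuous_on_def intro: tendsto_within_subset)
  \<comment> \<open>The limit of the continuous right-hand side carries over because both functions
    agree on \<open>nonresonant\<close>.\<close>
  moreover have "\<forall>\<^sub>F x in at (a, b) within nonresonant.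
      (\<lambda>(a', b'). rhs_sine a' b') x = (\<lambda>(a', b'). lhs_sum a' b') x"
    by (auto simp: eventually_at_filter nonresonant_def lhs_sum_eq_rhs_sine intro!: always_eventually)
  ultimately show "((\<lambda>(a', b'). lhs_sum a' b') \<longlongrightarrow> rhs_sine a b) (at (a, b) within nonresonant)"
    by (rule Lim_transform_eventually)
qed (fact closure_nonresonant continuous_on_rhs_sine)+

end
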